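(* Fractional behaviors of the form $$g(Z(s),\sigma,\rho;\epsilon)=K(\sigma,\rho;\epsilon)\,Z(s)^{n(\sigma,\rho)}$$ satisfying the simplified functional relation $$g(Z(s),\sigma,\rho)\,g(Z(\sigma s),\rho,\sigma)=\frac{Z(s)}{1+\epsilon}$$ possess a fractional exponent given by $$n(\sigma,\rho)=\frac{\ln(\sigma)}{\ln(\sigma\rho)} .$$
   Context: Here $Z(s)=\frac{1}{sR_1C_1}$, where $s$ is the Laplace variable and $R_1,C_1$ are the first resistance and capacitance of a fractal Cauer type RC ladder network, i.e. one whose resistances and capacitances satisfy $R(k+1)=\sigma R(k)$, $C(k+1)=\rho C(k)$ with constants $\sigma,\rho$. The number $\epsilon>0$ is small ($\epsilon\ll 1$). The unknown $g$ is a function of $Z(s)$ and of the ordered pair of parameters $(\sigma,\rho)$ (and of $\epsilon$); the coefficient $K$ and the exponent $n$ are functions of the ordered pair of parameters (and $K$ also of $\epsilon$), so that $g(Z(\sigma s),\rho,\sigma)$ is obtained from the assumed form by exchanging the two parameters and replacing $s$ by $\sigma s$. In the functional relation the dependence of $g$ on $\epsilon$ is not displayed. The simplified relation is an approximation of the exact relation $g(Z(s),\sigma,\rho)=\frac{Z(s)}{1+g(Z(\sigma s),\rho,\sigma)}$ satisfied by the continued fraction describing the network's transfer function, in the regime where $|g|$ is large. *)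

theory Defs
  imports "HOL-Analysis.Analysis"
begin

definition ladder_Z :: "real \<Rightarrow> real \<Rightarrow> complex \<Rightarrow> complex" where
  "ladder_Z R1 C1 s = 1 / (s * of_real R1 * of_real C1)"

text \<open>
  The Laplace variable ranges over the open right half-plane. This set is stable under
  scaling by a positive factor and under inversion, so every power below has its base in the
  open right half-plane, away from the branch cut of the principal branch used by \<open>powr\<close>.

  The set \<open>D\<close> consists of the ordered pairs \<open>(\<sigma>, \<rho>)\<close> of parameters for which the family
  \<open>g\<close> is considered. The arguments of \<open>g\<close> are the value of \<open>Z\<close>, the ordered pair of
  parameters, and \<open>\<epsilon>\<close>.
\<close>

definition fractional_behavior ::
  "(complex \<Rightarrow> complex) \<Rightarrow> (real \<times> real) set \<Rightarrow> real
   \<Rightarrow> (complex \<Rightarrow> real \<Rightarrow> real \<Rightarrow> real \<Rightarrow> complex)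
   \<Rightarrow> (real \<Rightarrow> real \<Rightarrow> real \<Rightarrow> complex) \<Rightarrow> (real \<Rightarrow> real \<Rightarrow> real) \<Rightarrow> bool" where
  "fractional_behavior Z D \<epsilon> g K n \<longleftrightarrow>
     (\<forall>(\<sigma>, \<rho>) \<in> D. \<forall>s. Re s > 0 \<longrightarrow>
        g (Z s) \<sigma> \<rho> \<epsilon> = K \<sigma> \<rho> \<epsilon> * Z s powr of_real (n \<sigma> \<rho>))"

definition simplified_relation ::
  "(complex \<Rightarrow> complex) \<Rightarrow> (real \<times> real) set \<Rightarrow> real
   \<Rightarrow> (complex \<Rightarrow> real \<Rightarrow> real \<Rightarrow> real \<Rightarrow> complex) \<Rightarrow> bool" where
  "simplified_relation Z D \<epsilon> g \<longleftrightarrow>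
     (\<forall>(\<sigma>, \<rho>) \<in> D. \<forall>s. Re s > 0 \<longrightarrow>
        g (Z s) \<sigma> \<rho> \<epsilon> * g (Z (of_real \<sigma> * s)) \<rho> \<sigma> \<epsilon> = Z s / of_real (1 + \<epsilon>))"

end

theory Submission
  imports Defs
begin

text \<open>
  Restricting the relation to positive real values \<open>x\<close> of \<open>Z\<close> gives, with \<open>m = n \<sigma> \<rho>\<close>,
  \<open>m' = n \<rho> \<sigma>\<close> and \<open>c = K \<sigma> \<rho> \<epsilon> * K \<rho> \<sigma> \<epsilon>\<close>, the identity
  \<open>c * x powr m * (x / \<sigma>) powr m' = x / (1 + \<epsilon>)\<close>. Comparing \<open>x = 1\<close> with one other value
  yields \<open>m + m' = 1\<close> and \<open>c = \<sigma> powr m' / (1 + \<epsilon>)\<close>. The constant \<open>c\<close> is symmetric in the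
  two parameters, so exchanging them gives \<open>\<sigma> powr (1 - m) = \<rho> powr m\<close>; take logarithms.
\<close>

lemma ladder_Z_of_real:
  assumes "x > 0" "R1 > 0" "C1 > 0"
  shows "ladder_Z R1 C1 (of_real (1 / (x * R1 * C1))) = of_real x"
    and "ladder_Z R1 C1 (of_real a * of_real (1 / (x * R1 * C1))) = of_real (x / a)"
  using assms by (simp_all add: ladder_Z_def field_simps)

text \<open>At positive real values of Z the complex powers reduce to real ones, so the comparison
  of exponents can be done over the reals.\<close>

lemma fractional_simplified_on_reals:
  assumes "R1 > 0" "C1 > 0"
    and frac: "fractional_behavior (ladder_Z R1 C1) D \<epsilon> g K n"
    and rel: "simplified_relation (ladder_Z R1 C1) D \<epsilon> g"
    and "(a, b) \<in> D" "(b, a) \<in> D" "a > 0" "x > 0"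
  shows "K a b \<epsilon> * K b a \<epsilon> * of_real (x powr n a b * (x / a) powr n b a)
           = of_real (x / (1 + \<epsilon>))"
proof -
  \<comment> \<open>The preimage of \<open>x\<close> under Z. It is real and positive, so both
    \<open>s\<close> and its multiple by \<open>a\<close> lie in the half-plane.\<close>
  define s :: complex where "s = of_real (1 / (x * R1 * C1))"
  have s: "Re s > 0" "Re (of_real a * s) > 0"
    using assms by (simp_all add: s_def)
  have Z: "ladder_Z R1 C1 s = of_real x" "ladder_Z R1 C1 (of_real a * s) = of_real (x / a)"
    unfolding s_def using assms ladder_Z_of_real by blast+
  have "g (of_real x) a b \<epsilon> = K a b \<epsilon> * of_real x powr of_real (n a b)"
    using frac \<open>(a, b) \<in> D\<close> s(1) Z(1) unfolding fractional_behavior_def by fastforce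
  \<comment> \<open>The assumed form for the exchanged pair, evaluated at the scaled point.\<close>
  moreover have "g (of_real (x / a)) b a \<epsilon> = K b a \<epsilon> * of_real (x / a) powr of_real (n b a)"
    using frac \<open>(b, a) \<in> D\<close> s(2) Z(2) unfolding fractional_behavior_def by fastforce
  moreover have "g (of_real x) a b \<epsilon> * g (of_real (x / a)) b a \<epsilon> = of_real x / of_real (1 + \<epsilon>)"
    using rel \<open>(a, b) \<in> D\<close> s(1) Z unfolding simplified_relation_def by fastforce
  moreover have "of_real x powr of_real (n a b) = complex_of_real (x powr n a b)"
    "of_real (x / a) powr of_real (n b a) = complex_of_real ((x / a) powr n b a)"
    using assms by (intro powr_of_real; simp)+
  ultimately show ?thesis
    by (simp add: mult_ac)
qed

text \<open>The left side is a constant times \<open>x powr (m + m')\<close>, the right side a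
  constant times \<open>x\<close>; exponents and coefficients must agree.\<close>

lemma scaled_power_law:
  fixes a m m' e :: real and c :: complex
  assumes "a > 0" "e > 0"
    and eq: "\<And>x. x > 0 \<Longrightarrow> c * of_real (x powr m * (x / a) powr m') = of_real (x / e)"
  shows "m + m' = 1" and "c = of_real (a powr m' / e)"
proof -
  have "c * of_real (1 / a powr m') = of_real (1 / e)"
    using eq[of 1] \<open>a > 0\<close> by (simp add: powr_divide)
  then show c: "c = of_real (a powr m' / e)"
    using assms by (simp add: field_simps)
  \<comment> \<open>Inserting \<open>c\<close> cancels the powers of \<open>a\<close>. Any positive
    base other than 1 would serve in place of 2.\<close>
  have "complex_of_real (2 powr (m + m') / e) = of_real (2 / e)"
    using eq[of 2] assms c by (simp add: powr_divide powr_add)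
  then have "2 powr (m + m') / e = 2 / e"
    unfolding of_real_eq_iff .
  then have "2 powr (m + m') = (2 :: real) powr 1"
    using \<open>e > 0\<close> by simp
  then show "m + m' = 1"
    by (subst (asm) powr_inj) auto
qed

theorem theorem6p2:
  fixes R1 C1 \<epsilon> \<sigma> \<rho> :: real
    and D :: "(real \<times> real) set"
    and g :: "complex \<Rightarrow> real \<Rightarrow> real \<Rightarrow> real \<Rightarrow> complex"
    and K :: "real \<Rightarrow> real \<Rightarrow> real \<Rightarrow> complex"
    and n :: "real \<Rightarrow> real \<Rightarrow> real"
  assumes "R1 > 0" and "C1 > 0" and "\<epsilon> > 0"
    and "\<And>a b. (a, b) \<in> D \<Longrightarrow> a > 0 \<and> b > 0"
    and "\<And>a b. (a, b) \<in> D \<Longrightarrow> (b, a) \<in> D"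
    and "fractional_behavior (ladder_Z R1 C1) D \<epsilon> g K n"
    and "simplified_relation (ladder_Z R1 C1) D \<epsilon> g"
    and "(\<sigma>, \<rho>) \<in> D" and "\<sigma> * \<rho> \<noteq> 1"
  shows "n \<sigma> \<rho> = ln \<sigma> / ln (\<sigma> * \<rho>)"
proof -
  note pos = assms(4) and swap = assms(5)
  have \<sigma>\<rho>: "(\<rho>, \<sigma>) \<in> D" "\<sigma> > 0" "\<rho> > 0" "1 + \<epsilon> > 0"
    using pos swap \<open>(\<sigma>, \<rho>) \<in> D\<close> \<open>\<epsilon> > 0\<close> by (blast, blast, blast, simp)
  note on_reals = fractional_simplified_on_reals[OF assms(1,2,6,7)]
  note law = scaled_power_law[OF \<open>\<sigma> > 0\<close> \<open>1 + \<epsilon> > 0\<close> on_reals[OF assms(8) \<sigma>\<rho>(1,2)]]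
  note law' = scaled_power_law[OF \<open>\<rho> > 0\<close> \<open>1 + \<epsilon> > 0\<close> on_reals[OF \<sigma>\<rho>(1) assms(8) \<sigma>\<rho>(3)]]
  have "complex_of_real (\<sigma> powr n \<rho> \<sigma> / (1 + \<epsilon>)) = of_real (\<rho> powr n \<sigma> \<rho> / (1 + \<epsilon>))"
    using law(2) law'(2) by (metis mult.commute)
  then have "\<sigma> powr n \<rho> \<sigma> / (1 + \<epsilon>) = \<rho> powr n \<sigma> \<rho> / (1 + \<epsilon>)"
    unfolding of_real_eq_iff .
  \<comment> \<open>The common factor \<open>1 + \<epsilon>\<close> cancels, so the exponent is free
    of \<epsilon>.\<close>
  then have "ln (\<sigma> powr n \<rho> \<sigma>) = ln (\<rho> powr n \<sigma> \<rho>)"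
    using \<open>1 + \<epsilon> > 0\<close> by simp
  then have "n \<rho> \<sigma> * ln \<sigma> = n \<sigma> \<rho> * ln \<rho>"
    using \<sigma>\<rho> by (simp add: ln_powr)
  moreover have "n \<rho> \<sigma> = 1 - n \<sigma> \<rho>"
    using law(1) by simp
  ultimately have "n \<sigma> \<rho> * ln (\<sigma> * \<rho>) = ln \<sigma>"
    using \<sigma>\<rho> by (simp add: ln_mult algebra_simps)
  \<comment> \<open>Here \<sigma>\<rho> \<noteq> 1 makes the linear equation for the exponent
    uniquely solvable.\<close>
  moreover have "ln (\<sigma> * \<rho>) \<noteq> 0"
    using \<sigma>\<rho> \<open>\<sigma> * \<rho> \<noteq> 1\<close> by (metis ln_eq_zero_iff mult_pos_pos)
  ultimately show ?thesis
    by (simp add: field_simps)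
qed

end
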